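(* Let $p$ be a prime and $n$ a positive integer. Let $\mathcal F\subset 2^{[n]}$ be a $(p+1)$-wise $p$-divisible set family. If $|\mathcal F|>2^{\lfloor n/p\rfloor-1}$, then $\mathcal F$ is contained in an atomic family with atoms of size $p$; that is, there exist pairwise disjoint subsets $B_1,\dots,B_a\subset[n]$, each of cardinality $p$, such that every member of $\mathcal F$ is a union of some of the $B_i$.
   Context: A family $\mathcal F\subset 2^{[n]}$ is called $k$-wise $\ell$-divisible if $|A_1\cap\cdots\cap A_k|$ is divisible by $\ell$ for all (not necessarily distinct) $A_1,\dots,A_k\in\mathcal F$. An atomic family is the family of all unions (including the empty union) of some pairwise disjoint subsets of $[n]$, called its atoms. *)

theory Defs
  imports
    Complex_Main
    "HOL-Library.Disjoint_Sets"
    "HOL-Computational_Algebra.Primes"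
begin

text \<open>The members of the tuple need not be distinct. The notion is meant for \<open>k \<ge> 1\<close> and
  families of finite sets: for \<open>k = 0\<close> the intersection would be the whole type.\<close>

definition wise_divisible :: "nat \<Rightarrow> nat \<Rightarrow> 'a set set \<Rightarrow> bool" where
  "wise_divisible k l F \<longleftrightarrow>
     (\<forall>A :: nat \<Rightarrow> 'a set. (\<forall>i\<in>{1..k}. A i \<in> F) \<longrightarrow> l dvd card (\<Inter>i\<in>{1..k}. A i))"

text \<open>\<open>atomic_family_on X Bs G\<close>: \<open>G\<close> is the atomic family of subsets of \<open>X\<close> with set of atoms \<open>Bs\<close>.\<close>

definition atomic_family_on :: "'a set \<Rightarrow> 'a set set \<Rightarrow> 'a set set \<Rightarrow> bool" where
  "atomic_family_on X Bs G \<longleftrightarrow> Bs \<subseteq> Pow X \<and> disjoint Bs \<and> G = {\<Union>S |S. S \<subseteq> Bs}"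

end

theory Submission
  imports Defs "HOL-Number_Theory.Cong"
begin

text \<open>Let \<open>X\<close> be the set of classes of elements of \<open>[n]\<close> that lie in the same members of \<open>F\<close>,
  weighted by their sizes \<open>m\<close>. If \<open>p\<close> divides every weight, the classes can be cut into atoms of
  size \<open>p\<close>. Otherwise, let \<open>V\<close> be the span of the indicators of the members over the field with \<open>p\<close>
  elements and \<open>U\<close> the span of \<open>V\<close> and the constants. The hypothesis says that the functional with
  weights \<open>m\<close> annihilates all products of one element of \<open>V\<close> and \<open>p\<close> elements of \<open>U\<close>. Since
  \<open>|F| \<le> 2 ^ dim V\<close>, it suffices to show \<open>p * (dim V + 1) \<le> n\<close>.

  Let \<open>x\<close> have weight prime to \<open>p\<close>. No product as above isolates \<open>x\<close>, so by an argument in the style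
  of Edmonds' matroid partition theorem \<open>x\<close> lies in a set \<open>R\<close> that is large compared with its ranks;
  for maximal \<open>R\<close> the annihilation property passes to \<open>R\<close>. On \<open>R\<close> a product of \<open>rk U R - 1\<close>
  elements of \<open>U\<close> isolates \<open>x\<close>, which forces \<open>rk U R \<ge> p + 2\<close> and then
  \<open>m(R) \<ge> p * (rk V R + 1)\<close>. Repeating the argument with the elements of \<open>V\<close> that vanish on the
  union \<open>T\<close> of the blocks found so far extends this to all of \<open>X\<close>.\<close>

section \<open>Ranks modulo a prime\<close>

text \<open>A subgroup of the integer-valued functions. Modulo \<open>p\<close> it becomes a vector
  space over the field with \<open>p\<close> elements, because scalars of that field act as repeated
  sums; so linear algebra is done with integers and divisibility.\<close>

definition int_subspace :: "('a \<Rightarrow> int) set \<Rightarrow> bool" where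
  "int_subspace W \<longleftrightarrow> (\<lambda>_. 0) \<in> W \<and> (\<forall>u\<in>W. \<forall>v\<in>W. (\<lambda>x. u x - v x) \<in> W)"

lemma int_subspace_zero: "int_subspace W \<Longrightarrow> (\<lambda>_. 0) \<in> W"
  and int_subspace_diff: "int_subspace W \<Longrightarrow> u \<in> W \<Longrightarrow> v \<in> W \<Longrightarrow> (\<lambda>x. u x - v x) \<in> W"
  by (auto simp: int_subspace_def)

lemma int_subspace_add:
  assumes "int_subspace W" "u \<in> W" "v \<in> W"
  shows "(\<lambda>x. u x + v x) \<in> W"
proof -
  have "(\<lambda>x. 0 - v x) \<in> W"
    using int_subspace_diff[OF assms(1) int_subspace_zero[OF assms(1)] assms(3)] by simp
  from int_subspace_diff[OF assms(1,2) this] show ?thesis by simp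
qed

lemma int_subspace_scale:
  assumes "int_subspace W" "v \<in> W"
  shows "(\<lambda>x. k * v x) \<in> W"
proof -
  have nat: "(\<lambda>x. int j * v x) \<in> W" for j
  proof (induction j)
    case 0
    then show ?case using int_subspace_zero[OF assms(1)] by simp
  next
    case (Suc j)
    from int_subspace_add[OF assms(1) Suc assms(2)] show ?case by (simp add: algebra_simps)
  qed
  show ?thesis
  proof (cases k rule: int_cases2)
    case (nonneg j)
    then show ?thesis using nat by simp
  next
    case (nonpos j)
    then show ?thesis
      using int_subspace_diff[OF assms(1) int_subspace_zero[OF assms(1)] nat[of j]] by simp
  qed
qed

text \<open>One generator enters per step, with either sign, which gives an induction suited to
  additive statements.\<close>

inductive_set int_span :: "('a \<Rightarrow> int) set \<Rightarrow> ('a \<Rightarrow> int) set" for G where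
  int_span_zero: "(\<lambda>_. 0) \<in> int_span G"
| int_span_add: "v \<in> int_span G \<Longrightarrow> g \<in> G \<Longrightarrow> (\<lambda>x. v x + g x) \<in> int_span G"
| int_span_diff: "v \<in> int_span G \<Longrightarrow> g \<in> G \<Longrightarrow> (\<lambda>x. v x - g x) \<in> int_span G"

lemma int_subspace_span: "int_subspace (int_span G)"
proof -
  have "(\<lambda>x. u x - v x) \<in> int_span G" if u: "u \<in> int_span G" and "v \<in> int_span G" for u v
    using that(2)
  proof induction
    case int_span_zero
    then show ?case using u by simp
  next
    case (int_span_add v g)
    from int_span.int_span_diff[OF int_span_add.IH int_span_add.hyps(2)]
    show ?case by (simp add: algebra_simps)
  next
    case (int_span_diff v g)
    from int_span.int_span_add[OF int_span_diff.IH int_span_diff.hyps(2)]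
    show ?case by (simp add: algebra_simps)
  qed
  then show ?thesis
    by (auto simp: int_subspace_def intro: int_span.int_span_zero)
qed

lemma int_span_base: "g \<in> G \<Longrightarrow> g \<in> int_span G"
  using int_span_add[OF int_span_zero, of g G] by simp

lemma int_span_mono: "G \<subseteq> H \<Longrightarrow> int_span G \<subseteq> int_span H"
proof
  fix v assume "G \<subseteq> H" "v \<in> int_span G"
  from this(2) show "v \<in> int_span H"
    by induction (use \<open>G \<subseteq> H\<close> in \<open>auto intro: int_span.intros\<close>)
qed

text \<open>The sum is linear in each factor, so divisibility extends from generators to spans one
  factor at a time.\<close>

lemma dvd_sum_prod_int_span:
  fixes m :: "'a \<Rightarrow> int" and d :: int
  assumes "finite I"
    and "\<And>f. (\<forall>i\<in>I. f i \<in> G i) \<Longrightarrow> d dvd (\<Sum>x\<in>X. m x * (\<Prod>i\<in>I. f i x))"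
    and "\<forall>i\<in>I. f i \<in> int_span (G i)"
  shows "d dvd (\<Sum>x\<in>X. m x * (\<Prod>i\<in>I. f i x))"
proof -
  \<comment> \<open>\<open>J\<close> collects the factors already ranging over spans; the others are
    still generators.\<close>
  have "finite J \<Longrightarrow> J \<subseteq> I \<Longrightarrow> (\<forall>i\<in>J. f i \<in> int_span (G i)) \<Longrightarrow> (\<forall>i\<in>I-J. f i \<in> G i)
    \<Longrightarrow> d dvd (\<Sum>x\<in>X. m x * (\<Prod>i\<in>I. f i x))" for J f
  proof (induction J arbitrary: f rule: finite_induct)
    case empty
    then show ?case using assms(2) by simp
  next
    case (insert j J)
    have jI: "j \<in> I" using insert.prems by auto
    have split: "(\<Prod>i\<in>I. (f(j := h)) i x) = h x * (\<Prod>i\<in>I-{j}. f i x)" for h x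
    proof -
      have "(\<Prod>i\<in>I. (f(j := h)) i x) = (f(j := h)) j x * (\<Prod>i\<in>I-{j}. (f(j := h)) i x)"
        using prod.remove[OF assms(1) jI] by blast
      also have "(\<Prod>i\<in>I-{j}. (f(j := h)) i x) = (\<Prod>i\<in>I-{j}. f i x)"
        by (rule prod.cong) auto
      finally show ?thesis by simp
    qed
    have gen: "d dvd (\<Sum>x\<in>X. m x * (h x * (\<Prod>i\<in>I-{j}. f i x)))" if "h \<in> G j" for h
    proof -
      have "d dvd (\<Sum>x\<in>X. m x * (\<Prod>i\<in>I. (f(j := h)) i x))"
        by (rule insert.IH) (use insert.prems insert.hyps that in auto)
      then show ?thesis unfolding split .
    qed
    have "d dvd (\<Sum>x\<in>X. m x * (h x * (\<Prod>i\<in>I-{j}. f i x)))" if "h \<in> int_span (G j)" for h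
      using that
    proof induction
      case int_span_zero
      then show ?case by simp
    next
      case (int_span_add v g)
      have "(\<Sum>x\<in>X. m x * ((v x + g x) * (\<Prod>i\<in>I-{j}. f i x)))
        = (\<Sum>x\<in>X. m x * (v x * (\<Prod>i\<in>I-{j}. f i x))) + (\<Sum>x\<in>X. m x * (g x * (\<Prod>i\<in>I-{j}. f i x)))"
        by (simp add: algebra_simps sum.distrib)
      then show ?case using int_span_add.IH gen[OF int_span_add.hyps(2)] by simp
    next
      case (int_span_diff v g)
      have "(\<Sum>x\<in>X. m x * ((v x - g x) * (\<Prod>i\<in>I-{j}. f i x)))
        = (\<Sum>x\<in>X. m x * (v x * (\<Prod>i\<in>I-{j}. f i x))) - (\<Sum>x\<in>X. m x * (g x * (\<Prod>i\<in>I-{j}. f i x)))"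
        by (simp add: algebra_simps sum_subtractf)
      then show ?case using int_span_diff.IH gen[OF int_span_diff.hyps(2)] by simp
    qed
    from this[of "f j"] have "d dvd (\<Sum>x\<in>X. m x * (\<Prod>i\<in>I. (f(j := f j)) i x))"
      unfolding split using insert.prems by simp
    then show ?case by simp
  qed
  from this[of I f] show ?thesis using assms by simp
qed

section \<open>Restrictions of functions modulo \<open>p\<close>\<close>

locale prime_modulus =
  fixes p :: nat
  assumes prime_p: "prime p"
begin

lemma p_pos: "p > 0" and p_ge_2: "p \<ge> 2"
  using prime_p prime_gt_0_nat prime_ge_2_nat by auto

lemma prime_int_p: "prime (int p)"
  using prime_p by simp

lemma exists_cancel:
  fixes a u :: int
  assumes "\<not> int p dvd u"
  shows "\<exists>k. int p dvd a + k * u"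
proof -
  have "coprime u (int p)"
    using assms prime_imp_coprime[OF prime_int_p] by (simp add: coprime_commute)
  then obtain k where k: "[u * k = 1] (mod int p)"
    using cong_solve_coprime_int by blast
  then have "int p dvd u * k - 1" by (simp add: cong_iff_dvd_diff)
  then have "int p dvd - a * (u * k - 1)" by (rule dvd_mult)
  also have "- a * (u * k - 1) = a + (- a * k) * u" by (simp add: algebra_simps)
  finally show ?thesis by blast
qed

definition ann :: "('a \<Rightarrow> int) set \<Rightarrow> 'a set \<Rightarrow> ('a \<Rightarrow> int) set" where
  "ann W S = {v \<in> W. \<forall>s\<in>S. int p dvd v s}"

text \<open>For finite \<open>S\<close>: evaluation at \<open>y\<close> is a linear combination
  modulo \<open>p\<close> of evaluations at points of \<open>S\<close>, phrased dually through the
  functions vanishing on \<open>S\<close>. This is closure in the matroid of evaluations.\<close>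

definition dep :: "('a \<Rightarrow> int) set \<Rightarrow> 'a set \<Rightarrow> 'a \<Rightarrow> bool" where
  "dep W S y \<longleftrightarrow> (\<forall>v\<in>ann W S. int p dvd v y)"

text \<open>The value 0 outside \<open>S\<close> makes restrictions total functions that are equal
  exactly when they agree modulo \<open>p\<close> on \<open>S\<close>.\<close>

definition residues :: "('a \<Rightarrow> int) set \<Rightarrow> 'a set \<Rightarrow> ('a \<Rightarrow> int) set" where
  "residues W S = (\<lambda>v s. if s \<in> S then v s mod int p else 0) ` W"

text \<open>The dimension over the field with \<open>p\<close> elements of the restriction of \<open>W\<close> to \<open>S\<close>:
  \<open>residues W S\<close> has \<open>p ^ rk W S\<close> elements.\<close>

definition rk :: "('a \<Rightarrow> int) set \<Rightarrow> 'a set \<Rightarrow> nat" where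
  "rk W S = multiplicity p (card (residues W S))"

lemma int_subspace_ann: "int_subspace W \<Longrightarrow> int_subspace (ann W S)"
  by (auto simp: int_subspace_def ann_def)

lemma ann_subset: "ann W S \<subseteq> W"
  by (auto simp: ann_def)

lemma dep_ann_iff: "dep (ann W T) S y \<longleftrightarrow> dep W (T \<union> S) y"
  by (auto simp: dep_def ann_def)

lemma dep_mono: "dep W S y \<Longrightarrow> S \<subseteq> T \<Longrightarrow> dep W T y"
  by (auto simp: dep_def ann_def)

lemma finite_residues:
  assumes "finite S"
  shows "finite (residues W S)"
proof -
  have "residues W S \<subseteq> {f. \<forall>x. (x \<in> S \<longrightarrow> f x \<in> {0..<int p}) \<and> (x \<notin> S \<longrightarrow> f x = 0)}"
    using p_pos by (auto simp: residues_def)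
  then show ?thesis
    using finite_set_of_finite_funs[OF assms, of "{0..<int p}" 0] finite_subset by blast
qed

lemma residues_nonempty: "int_subspace W \<Longrightarrow> residues W S \<noteq> {}"
  using int_subspace_zero by (auto simp: residues_def)

text \<open>Functions in \<open>W\<close> congruent on \<open>S\<close> differ by an element of
  \<open>ann W S\<close>, so they are congruent at \<open>y\<close> too, and restricting to
  \<open>S\<close> is injective.\<close>

lemma card_residues_insert_dep:
  assumes W: "int_subspace W" and d: "dep W S y"
  shows "card (residues W (insert y S)) = card (residues W S)"
proof -
  let ?r = "\<lambda>T v s. if s \<in> T then v s mod int p else 0"
  have "bij_betw (\<lambda>f s. if s \<in> S then f s else 0) (residues W (insert y S)) (residues W S)"
  proof (rule bij_betw_imageI)
    show "inj_on (\<lambda>f s. if s \<in> S then f s else 0) (residues W (insert y S))"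
    proof (rule inj_onI)
      fix f g
      assume "f \<in> residues W (insert y S)" "g \<in> residues W (insert y S)"
        and eq: "(\<lambda>s. if s \<in> S then f s else 0) = (\<lambda>s. if s \<in> S then g s else 0)"
      then obtain u v where u: "u \<in> W" "f = ?r (insert y S) u" and v: "v \<in> W" "g = ?r (insert y S) v"
        by (auto simp: residues_def)
      have *: "u s mod int p = v s mod int p" if "s \<in> S" for s
        using fun_cong[OF eq, of s] that u v by simp
      then have "(\<lambda>x. u x - v x) \<in> ann W S"
        using int_subspace_diff[OF W u(1) v(1)] by (auto simp: ann_def mod_eq_dvd_iff)
      then have "u y mod int p = v y mod int p"
        using d by (auto simp: dep_def mod_eq_dvd_iff)
      then show "f = g" using * u v by auto
    qed
    show "(\<lambda>f s. if s \<in> S then f s else 0) ` residues W (insert y S) = residues W S"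
      unfolding residues_def image_image by (rule image_cong) auto
  qed
  then show ?thesis by (rule bij_betw_same_card)
qed

text \<open>Some \<open>e\<close> in \<open>W\<close> vanishes on \<open>S\<close> but not at
  \<open>y\<close>. Adding multiples of \<open>e\<close> sets the value at \<open>y\<close> freely
  while keeping the values on \<open>S\<close>, so the residues form a product.\<close>

lemma card_residues_insert_indep:
  assumes W: "int_subspace W" and d: "\<not> dep W S y"
  shows "card (residues W (insert y S)) = p * card (residues W S)"
proof -
  let ?r = "\<lambda>T v s. if s \<in> T then v s mod int p else 0"
  obtain e where e: "e \<in> W" "\<forall>s\<in>S. int p dvd e s" "\<not> int p dvd e y"
    using d by (auto simp: dep_def ann_def)
  have yS: "y \<notin> S" using e by auto
  have "bij_betw (\<lambda>f. (\<lambda>s. if s \<in> S then f s else 0, f y))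
    (residues W (insert y S)) (residues W S \<times> {0..<int p})"
  proof (rule bij_betw_imageI)
    show "inj_on (\<lambda>f. (\<lambda>s. if s \<in> S then f s else 0, f y)) (residues W (insert y S))"
    proof (rule inj_onI)
      fix f g
      assume "f \<in> residues W (insert y S)" "g \<in> residues W (insert y S)"
        and eq: "((\<lambda>s. if s \<in> S then f s else 0), f y) = ((\<lambda>s. if s \<in> S then g s else 0), g y)"
      then obtain u v where u: "f = ?r (insert y S) u" and v: "g = ?r (insert y S) v"
        by (auto simp: residues_def)
      have eq': "(\<lambda>s. if s \<in> S then f s else 0) = (\<lambda>s. if s \<in> S then g s else 0)"
        and y: "f y = g y"
        using eq by (simp_all only: prod.inject)
      have "f s = g s" for s
      proof (cases "s \<in> insert y S")
        case True
        then show ?thesis using y fun_cong[OF eq', of s] by (cases "s = y") auto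
      qed (simp add: u v)
      then show "f = g" by (rule ext)
    qed
    show "(\<lambda>f. (\<lambda>s. if s \<in> S then f s else 0, f y)) ` residues W (insert y S)
      = residues W S \<times> {0..<int p}" (is "?L = ?R")
    proof
      show "?L \<subseteq> ?R"
      proof (rule image_subsetI)
        fix f assume "f \<in> residues W (insert y S)"
        then obtain v where v: "v \<in> W" "f = ?r (insert y S) v"
          by (auto simp: residues_def)
        then have "(\<lambda>s. if s \<in> S then f s else 0) = ?r S v" by auto
        with v p_pos show "(\<lambda>s. if s \<in> S then f s else 0, f y) \<in> ?R"
          by (auto simp: residues_def)
      qed
      show "?R \<subseteq> ?L"
      proof
        fix z assume "z \<in> ?R"
        then obtain v b where v: "v \<in> W" and b: "b \<in> {0..<int p}" and z: "z = (?r S v, b)"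
          by (auto simp: residues_def)
        obtain k where k: "int p dvd (v y - b) + k * e y"
          using exists_cancel[OF e(3)] by blast
        define u where "u = (\<lambda>x. v x + k * e x)"
        have "u \<in> W"
          unfolding u_def by (rule int_subspace_add[OF W v int_subspace_scale[OF W e(1)]])
        moreover have "u s mod int p = v s mod int p" if "s \<in> S" for s
          using e(2) that by (auto simp: u_def mod_eq_dvd_iff)
        moreover have "u y mod int p = b mod int p"
          using k by (simp add: u_def mod_eq_dvd_iff algebra_simps)
        then have "u y mod int p = b" using b by simp
        ultimately have "z = (\<lambda>s. if s \<in> S then ?r (insert y S) u s else 0, ?r (insert y S) u y)"
          unfolding z by auto
        then show "z \<in> ?L"
          unfolding residues_def image_image by (rule rev_image_eqI[OF \<open>u \<in> W\<close>])
      qed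
    qed
  qed
  from bij_betw_same_card[OF this] show ?thesis
    by (simp add: card_cartesian_product)
qed

section \<open>Rank as a matroid rank function\<close>

lemma rk_empty: "int_subspace W \<Longrightarrow> rk W {} = 0"
proof -
  assume "int_subspace W"
  then have "residues W {} = {\<lambda>_. 0}"
    using int_subspace_zero by (auto simp: residues_def)
  then show ?thesis by (simp add: rk_def)
qed

lemma rk_insert:
  assumes "int_subspace W" "finite S"
  shows "rk W (insert y S) = rk W S + (if dep W S y then 0 else 1)"
proof (cases "dep W S y")
  case True
  then show ?thesis using card_residues_insert_dep[OF assms(1)] by (simp add: rk_def)
next
  case False
  have "card (residues W S) \<noteq> 0"
    using finite_residues[OF assms(2)] residues_nonempty[OF assms(1)] by simp
  then have "multiplicity p (p * card (residues W S)) = Suc (multiplicity p (card (residues W S)))"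
    using prime_p by (intro multiplicity_times_same) (auto simp: prime_nat_iff)
  then show ?thesis
    using False card_residues_insert_indep[OF assms(1) False] by (simp add: rk_def)
qed

lemma card_residues:
  assumes "int_subspace W" "finite S"
  shows "card (residues W S) = p ^ rk W S"
  using assms(2)
proof (induction S rule: finite_induct)
  case empty
  have "residues W {} = {\<lambda>_. 0}"
    using int_subspace_zero[OF assms(1)] by (auto simp: residues_def)
  then show ?case by (simp add: rk_empty[OF assms(1)])
next
  case (insert y S)
  then show ?case
    using card_residues_insert_dep[OF assms(1)] card_residues_insert_indep[OF assms(1)]
    by (auto simp: rk_insert[OF assms(1)])
qed

text \<open>Rank-nullity for the restriction from \<open>T \<union> S\<close> to \<open>T\<close>:
  the kernel comes from the functions vanishing on \<open>T\<close>.\<close>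

lemma rk_Un:
  assumes "int_subspace W" "finite T" "finite S"
  shows "rk W (T \<union> S) = rk W T + rk (ann W T) S"
  using assms(3)
proof (induction S rule: finite_induct)
  case empty
  then show ?case by (simp add: rk_empty int_subspace_ann assms)
next
  case (insert y S)
  then show ?case
    by (simp add: rk_insert[OF assms(1)] rk_insert[OF int_subspace_ann[OF assms(1)]] assms dep_ann_iff)
qed

text \<open>Dependence on a set persists on larger sets, so each point of \<open>D\<close> raises
  the rank over \<open>A\<close> by at most as much as over the smaller \<open>C\<close>.\<close>

lemma rk_diminishing:
  assumes "int_subspace W" "finite A" "finite D" "C \<subseteq> A"
  shows "rk W (A \<union> D) + rk W C \<le> rk W A + rk W (C \<union> D)"
  using assms(3)
proof (induction D rule: finite_induct)
  case empty
  then show ?case by simp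
next
  case (insert y D)
  have "finite C" using assms finite_subset by blast
  moreover have "dep W (C \<union> D) y \<Longrightarrow> dep W (A \<union> D) y"
    using assms(4) by (elim dep_mono) auto
  ultimately show ?case
    using insert by (simp add: rk_insert[OF assms(1)] assms(2))
qed

lemma rk_submodular:
  assumes "int_subspace W" "finite A" "finite B"
  shows "rk W (A \<union> B) + rk W (A \<inter> B) \<le> rk W A + rk W B"
proof -
  have "A \<union> (B - A) = A \<union> B" "(A \<inter> B) \<union> (B - A) = B" by auto
  then show ?thesis
    using rk_diminishing[OF assms(1,2), of "B - A" "A \<inter> B"] assms(3) by simp
qed

lemma rk_mono:
  assumes "int_subspace W" "finite T" "S \<subseteq> T"
  shows "rk W S \<le> rk W T"
proof -
  have "S \<union> (T - S) = T" "finite S" using assms finite_subset by auto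
  then show ?thesis
    using rk_Un[OF assms(1), of S "T - S"] assms(2) by simp
qed

lemma rk_subspace_mono:
  assumes "int_subspace W" "int_subspace W'" "W \<subseteq> W'" "finite S"
  shows "rk W S \<le> rk W' S"
proof -
  have "card (residues W S) \<le> card (residues W' S)"
    by (intro card_mono finite_residues assms) (use assms(3) in \<open>auto simp: residues_def\<close>)
  then show ?thesis
    using card_residues assms prime_p prime_gt_1_nat by (metis power_le_imp_le_exp)
qed

lemma rk_singleton:
  assumes "int_subspace W" "v \<in> W" "\<not> int p dvd v x"
  shows "rk W {x} = 1"
  using rk_insert[OF assms(1), of "{}" x] assms
  by (auto simp: rk_empty dep_def ann_def)

text \<open>Nested finite sets of residues with equal rank have equal cardinality and hence
  coincide.\<close>

lemma rk_eq_imp_residues: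
  assumes "int_subspace W" "int_subspace W'" "W \<subseteq> W'" "finite S" "rk W S = rk W' S" "u \<in> W'"
  shows "\<exists>v\<in>W. \<forall>s\<in>S. v s mod int p = u s mod int p"
proof -
  have "residues W S = residues W' S"
  proof (rule card_subset_eq[OF finite_residues[OF assms(4)]])
    show "residues W S \<subseteq> residues W' S"
      using assms(3) by (auto simp: residues_def)
    show "card (residues W S) = card (residues W' S)"
      using card_residues[OF assms(1,4)] card_residues[OF assms(2,4)] assms(5) by simp
  qed
  then have "(\<lambda>s. if s \<in> S then u s mod int p else 0) \<in> residues W S"
    using assms(6) by (simp add: residues_def)
  then obtain v where v: "v \<in> W"
    and eq: "(\<lambda>s. if s \<in> S then u s mod int p else 0) = (\<lambda>s. if s \<in> S then v s mod int p else 0)"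
    unfolding residues_def by blast
  have "v s mod int p = u s mod int p" if "s \<in> S" for s
    using fun_cong[OF eq, of s] that by simp
  with v show ?thesis by blast
qed

section \<open>Covering by zero sets\<close>

text \<open>Points \<open>y \<in> D\<close> are assigned one by one to an index \<open>i\<close>, and \<open>W i\<close> is replaced by its elements
  vanishing at \<open>y\<close>. If no index is admissible for \<open>y\<close>, each is blocked by a tight set; the union \<open>S\<close>
  of these is tight by submodularity, and \<open>insert y S\<close> violates the rank condition.\<close>

lemma lift_to_vanishing_product:
  fixes W :: "'i \<Rightarrow> ('a \<Rightarrow> int) set"
  assumes "finite D" "finite R" "R \<inter> D = {}" "finite I"
    and "\<forall>i\<in>I. int_subspace (W i)"
    and "\<forall>S. R \<subseteq> S \<and> S \<subseteq> R \<union> D \<longrightarrow>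
      card S + (\<Sum>i\<in>I. rk (W i) R) \<le> card R + (\<Sum>i\<in>I. rk (W i) S)"
    and "\<forall>i\<in>I. f i \<in> W i"
  shows "\<exists>g. (\<forall>i\<in>I. g i \<in> W i) \<and> (\<forall>i\<in>I. \<forall>s\<in>R. int p dvd g i s - f i s) \<and>
    (\<forall>x\<in>D. \<exists>i\<in>I. int p dvd g i x)"
  using assms(1,3,5-7)
proof (induction D arbitrary: W f rule: finite_induct)
  case empty
  then show ?case by (intro exI[of _ f]) auto
next
  case (insert y D)
  note W = insert.prems(2) and rich = insert.prems(3) and fW = insert.prems(4)
  have fin: "finite (insert y D)" using insert.hyps by simp
  \<comment> \<open>Equality in the rank condition, for sets avoiding \<open>y\<close>: these leave
    no slack for a further loss of rank.\<close>
  define tight where "tight S \<longleftrightarrow> R \<subseteq> S \<and> S \<subseteq> R \<union> D \<and>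
    card S + (\<Sum>i\<in>I. rk (W i) R) = card R + (\<Sum>i\<in>I. rk (W i) S)" for S
  have finS: "finite S" if "R \<subseteq> S" "S \<subseteq> R \<union> insert y D" for S
    using that finite_subset[OF that(2)] assms(2) fin by simp
  \<comment> \<open>Cardinality is modular and ranks are submodular, so the slacks of
    \<open>A \<union> B\<close> and \<open>A \<inter> B\<close>, both nonnegative, add up to at most
    those of \<open>A\<close> and \<open>B\<close>, which are zero.\<close>
  have tight_Un: "tight (A \<union> B)" if A: "tight A" and B: "tight B" for A B
  proof -
    have fA: "finite A" and fB: "finite B" using A B finS[of A] finS[of B] by (auto simp: tight_def)
    have "(\<Sum>i\<in>I. rk (W i) (A \<union> B)) + (\<Sum>i\<in>I. rk (W i) (A \<inter> B))
      \<le> (\<Sum>i\<in>I. rk (W i) A) + (\<Sum>i\<in>I. rk (W i) B)"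
      unfolding sum.distrib[symmetric]
      by (intro sum_mono rk_submodular fA fB) (use W in auto)
    moreover have "card (A \<union> B) + card (A \<inter> B) = card A + card B"
      using card_Un_Int[OF fA fB] by simp
    moreover have "card (A \<union> B) + (\<Sum>i\<in>I. rk (W i) R) \<le> card R + (\<Sum>i\<in>I. rk (W i) (A \<union> B))"
      "card (A \<inter> B) + (\<Sum>i\<in>I. rk (W i) R) \<le> card R + (\<Sum>i\<in>I. rk (W i) (A \<inter> B))"
      using rich A B unfolding tight_def by (auto simp: le_infI1 intro!: rich[rule_format])
    ultimately show ?thesis using A B unfolding tight_def by auto
  qed
  have tight_R: "tight R" by (auto simp: tight_def)
  have "\<exists>i\<in>I. \<forall>S. tight S \<longrightarrow> \<not> dep (W i) S y"
  proof (rule ccontr)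
    assume "\<not> ?thesis"
    then obtain S where S: "\<And>i. i \<in> I \<Longrightarrow> tight (S i) \<and> dep (W i) (S i) y" by metis
    have "J \<subseteq> I \<Longrightarrow> tight (R \<union> (\<Union>i\<in>J. S i))" if "finite J" for J
      using that
    proof (induction J rule: finite_induct)
      case empty
      then show ?case using tight_R by simp
    next
      case (insert j J)
      then have "tight (R \<union> (\<Union>i\<in>J. S i))" "tight (S j)" using S by auto
      from tight_Un[OF this] have "tight ((R \<union> (\<Union>i\<in>J. S i)) \<union> S j)" .
      then show ?case by (simp add: Un_ac)
    qed
    from this[OF assms(4)] have t: "tight (R \<union> (\<Union>i\<in>I. S i))" (is "tight ?T") by simp
    have "y \<notin> ?T" using t insert.hyps insert.prems(1) by (auto simp: tight_def)
    have finT: "finite ?T" using t finS[of ?T] by (auto simp: tight_def)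
    have "dep (W i) ?T y" if "i \<in> I" for i
      using S[OF that] by (auto intro: dep_mono that)
    then have "(\<Sum>i\<in>I. rk (W i) (insert y ?T)) = (\<Sum>i\<in>I. rk (W i) ?T)"
      using W finT by (intro sum.cong) (simp_all add: rk_insert)
    moreover have "card (insert y ?T) + (\<Sum>i\<in>I. rk (W i) R) \<le> card R + (\<Sum>i\<in>I. rk (W i) (insert y ?T))"
      using t by (intro rich[rule_format]) (auto simp: tight_def)
    ultimately show False
      using t \<open>y \<notin> ?T\<close> finT by (simp add: tight_def)
  qed
  then obtain i where i: "i \<in> I" and ind: "\<And>S. tight S \<Longrightarrow> \<not> dep (W i) S y" by blast
  define W' where "W' = W(i := ann (W i) {y})"
  have W'_sub: "W' j \<subseteq> W j" for j by (auto simp: W'_def ann_def)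
  have W': "\<forall>j\<in>I. int_subspace (W' j)"
    using W by (auto simp: W'_def int_subspace_ann)
  \<comment> \<open>Computing the rank of \<open>W i\<close> on \<open>insert y S\<close> in two
    orders shows how much rank is lost on \<open>S\<close>.\<close>
  have rk_W': "(\<Sum>j\<in>I. rk (W' j) S) + rk (W i) {y} = (\<Sum>j\<in>I. rk (W j) S) + (if dep (W i) S y then 0 else 1)"
    if "finite S" for S
  proof -
    have "rk (W i) {y} + rk (ann (W i) {y}) S = rk (W i) S + (if dep (W i) S y then 0 else 1)"
      using rk_Un[of "W i" "{y}" S] rk_insert[of "W i" S y] W i that by simp
    moreover have "(\<Sum>j\<in>I - {i}. rk (W' j) S) = (\<Sum>j\<in>I - {i}. rk (W j) S)"
      by (rule sum.cong) (auto simp: W'_def)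
    moreover have "W' i = ann (W i) {y}" by (simp add: W'_def)
    ultimately show ?thesis
      by (simp add: sum.remove[OF assms(4) i])
  qed
  \<comment> \<open>As \<open>R\<close> is tight, \<open>y\<close> is independent of it and the loss
    on \<open>R\<close> is \<open>rk (W i) {y} - 1\<close>. On \<open>S\<close> the loss is the
    same, or one more if \<open>y\<close> depends on \<open>S\<close>; then \<open>S\<close> is not
    tight and its slack absorbs the extra one.\<close>
  have rich': "card S + (\<Sum>j\<in>I. rk (W' j) R) \<le> card R + (\<Sum>j\<in>I. rk (W' j) S)"
    if "R \<subseteq> S" "S \<subseteq> R \<union> D" for S
  proof -
    have "finite S" using that finS[of S] by auto
    have "card S + (\<Sum>j\<in>I. rk (W j) R) \<le> card R + (\<Sum>j\<in>I. rk (W j) S)"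
      using that by (intro rich[rule_format]) auto
    moreover have "\<not> tight S" if "dep (W i) S y"
      using ind that by blast
    ultimately show ?thesis
      using rk_W'[OF \<open>finite S\<close>] rk_W'[OF assms(2)] ind[OF tight_R] that
      by (auto simp: tight_def split: if_splits)
  qed
  obtain u where u: "u \<in> W i" "\<forall>s\<in>R. int p dvd u s" "\<not> int p dvd u y"
    using ind[OF tight_R] by (auto simp: dep_def ann_def)
  \<comment> \<open>Since \<open>u\<close> vanishes on \<open>R\<close> modulo \<open>p\<close>,
    adding a multiple of it makes \<open>f i\<close> vanish at \<open>y\<close> without changing it
    on \<open>R\<close>.\<close>
  obtain k where k: "int p dvd f i y + k * u y" using exists_cancel[OF u(3)] by blast
  define f' where "f' = f(i := (\<lambda>x. f i x + k * u x))"
  have "f' i \<in> W' i"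
    using int_subspace_add[of "W i" "f i" "\<lambda>x. k * u x"] int_subspace_scale[of "W i" u k] W fW i u k
    by (simp add: f'_def W'_def ann_def)
  then have f': "\<forall>j\<in>I. f' j \<in> W' j"
    using fW by (auto simp: f'_def W'_def)
  have "R \<inter> D = {}" using insert.prems(1) by auto
  then obtain g where g: "\<forall>j\<in>I. g j \<in> W' j" "\<forall>j\<in>I. \<forall>s\<in>R. int p dvd g j s - f' j s"
      "\<forall>x\<in>D. \<exists>j\<in>I. int p dvd g j x"
    using insert.IH[OF _ W' _ f'] rich' by blast
  have "int p dvd g j s - f j s" if "j \<in> I" "s \<in> R" for j s
  proof -
    have "int p dvd f' j s - f j s" using u(2) that(2) by (simp add: f'_def)
    then have "int p dvd (g j s - f' j s) + (f' j s - f j s)" using g(2) that by (intro dvd_add) auto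
    then show ?thesis by simp
  qed
  moreover have "int p dvd g i y" using g(1) i by (auto simp: W'_def ann_def)
  ultimately show ?case
    using g W'_sub i by (intro exI[of _ g]) blast
qed

text \<open>The obstruction to isolating \<open>x\<close> by a product of elements of the spaces \<open>W i\<close> is a set
  \<open>R\<close> of large cardinality compared with its ranks; if \<open>R\<close> is maximal, every product on \<open>R\<close> lifts to
  a product vanishing elsewhere, so the annihilated functional restricts to \<open>R\<close>.\<close>

lemma exists_dense_annihilated_set:
  fixes W :: "'i \<Rightarrow> ('a \<Rightarrow> int) set" and m :: "'a \<Rightarrow> nat"
  assumes "finite X" "finite I"
    and W: "\<forall>i\<in>I. int_subspace (W i)"
    and m: "\<forall>z\<in>X. \<not> p dvd m z"
    and kill: "\<And>f. \<forall>i\<in>I. f i \<in> W i \<Longrightarrow> int p dvd (\<Sum>z\<in>X. int (m z) * (\<Prod>i\<in>I. f i z))"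
    and x: "x \<in> X" "\<forall>i\<in>I. \<exists>v\<in>W i. \<not> int p dvd v x"
  shows "\<exists>R. R \<subseteq> X \<and> x \<in> R \<and> (\<Sum>i\<in>I. rk (W i) R) + 2 \<le> card R + card I \<and>
    (\<forall>f. (\<forall>i\<in>I. f i \<in> W i) \<longrightarrow> int p dvd (\<Sum>z\<in>R. int (m z) * (\<Prod>i\<in>I. f i z)))"
proof -
  have restrict: "int p dvd (\<Sum>z\<in>R. int (m z) * (\<Prod>i\<in>I. f i z))"
    if R: "R \<subseteq> X" and f: "\<forall>i\<in>I. f i \<in> W i"
      and rich: "\<And>S. R \<subseteq> S \<Longrightarrow> S \<subseteq> X \<Longrightarrow>
        card S + (\<Sum>i\<in>I. rk (W i) R) \<le> card R + (\<Sum>i\<in>I. rk (W i) S)" for R f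
  proof -
    have fR: "finite R" "finite (X - R)" using assms(1) R finite_subset by auto
    have X: "R \<union> (X - R) = X" using R by auto
    \<comment> \<open>Modulo \<open>p\<close> the lift \<open>g\<close> agrees with \<open>f\<close>
      on \<open>R\<close> and has a vanishing factor at every other point of \<open>X\<close>, so
      the sum over \<open>X\<close> reduces to the sum over \<open>R\<close>.\<close>
    obtain g where g: "\<forall>i\<in>I. g i \<in> W i" "\<forall>i\<in>I. \<forall>s\<in>R. int p dvd g i s - f i s"
        "\<forall>z\<in>X-R. \<exists>i\<in>I. int p dvd g i z"
      using lift_to_vanishing_product[of "X - R" R I W f] fR assms(2) W rich f X by auto
    have "int p dvd (\<Sum>z\<in>X. int (m z) * (\<Prod>i\<in>I. g i z))" by (rule kill[OF g(1)])
    also have "(\<Sum>z\<in>X. int (m z) * (\<Prod>i\<in>I. g i z)) =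
      (\<Sum>z\<in>R. int (m z) * (\<Prod>i\<in>I. g i z)) + (\<Sum>z\<in>X-R. int (m z) * (\<Prod>i\<in>I. g i z))"
      using sum.subset_diff[OF R assms(1)] by (simp add: add.commute)
    finally have "int p dvd (\<Sum>z\<in>R. int (m z) * (\<Prod>i\<in>I. g i z)) + (\<Sum>z\<in>X-R. int (m z) * (\<Prod>i\<in>I. g i z))" .
    moreover have "int p dvd (\<Sum>z\<in>X-R. int (m z) * (\<Prod>i\<in>I. g i z))"
      using g(3) assms(2) by (intro dvd_sum dvd_mult) (meson dvd_prodI dvd_trans)
    ultimately have *: "int p dvd (\<Sum>z\<in>R. int (m z) * (\<Prod>i\<in>I. g i z))"
      by (simp add: dvd_add_left_iff)
    have "[(\<Sum>z\<in>R. int (m z) * (\<Prod>i\<in>I. g i z)) = (\<Sum>z\<in>R. int (m z) * (\<Prod>i\<in>I. f i z))] (mod int p)"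
      using g(2) by (intro cong_sum cong_mult cong_prod) (auto simp: cong_iff_dvd_diff)
    then show ?thesis using * cong_dvd_iff by blast
  qed
  \<comment> \<open>This is the failure of the rank condition over \<open>{x}\<close>, where every
    rank is 1 and \<open>card {x} = 1\<close>; negating the weak inequality turns that 1 into
    2.\<close>
  define dense where "dense S \<longleftrightarrow> S \<subseteq> X \<and> x \<in> S \<and> (\<Sum>i\<in>I. rk (W i) S) + 2 \<le> card S + card I" for S
  have rk_x: "(\<Sum>i\<in>I. rk (W i) {x}) = card I"
  proof -
    have "rk (W i) {x} = 1" if "i \<in> I" for i
      using W x(2) that rk_singleton[of "W i" _ x] by blast
    then show ?thesis by simp
  qed
  have "\<exists>S. dense S"
  proof (rule ccontr)
    assume no: "\<nexists>S. dense S"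
    \<comment> \<open>Without dense sets the functional restricts to the single point
      \<open>x\<close>, where factors not divisible by \<open>p\<close> give a
      contradiction.\<close>
    obtain f where f: "\<forall>i\<in>I. f i \<in> W i \<and> \<not> int p dvd f i x" using x(2) by metis
    have "int p dvd (\<Sum>z\<in>{x}. int (m z) * (\<Prod>i\<in>I. f i z))"
    proof (rule restrict)
      fix S assume "{x} \<subseteq> S" "S \<subseteq> X"
      then have "\<not> (\<Sum>i\<in>I. rk (W i) S) + 2 \<le> card S + card I" using no by (auto simp: dense_def)
      then show "card S + (\<Sum>i\<in>I. rk (W i) {x}) \<le> card {x} + (\<Sum>i\<in>I. rk (W i) S)"
        by (simp add: rk_x)
    qed (use x f in auto)
    then have "int p dvd int (m x) \<or> (\<exists>i\<in>I. int p dvd f i x)"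
      using prime_int_p assms(2) by (simp add: prime_dvd_mult_iff prime_dvd_prod_iff)
    then show False using f m x(1) by auto
  qed
  then obtain S0 where S0: "dense S0" by blast
  have "\<forall>S. dense S \<longrightarrow> card S < Suc (card X)"
    using assms(1) by (auto simp: dense_def less_Suc_eq_le intro: card_mono)
  from ex_has_greatest_nat[OF S0 this]
  obtain R where R: "dense R" and max: "\<And>S. dense S \<Longrightarrow> card S \<le> card R" by blast
  \<comment> \<open>By maximality a strictly larger \<open>S\<close> is not dense; combining its
    failed inequality with density of \<open>R\<close> gives the rank condition over
    \<open>R\<close>.\<close>
  have rich: "card S + (\<Sum>i\<in>I. rk (W i) R) \<le> card R + (\<Sum>i\<in>I. rk (W i) S)"
    if "R \<subseteq> S" "S \<subseteq> X" for S
  proof (cases "S = R")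
    case False
    have "finite S" using that assms(1) finite_subset by blast
    then have "card R < card S" using that False by (intro psubset_card_mono) auto
    then have "\<not> dense S" using max by fastforce
    then show ?thesis using that R by (auto simp: dense_def)
  qed simp
  have RX: "R \<subseteq> X" using R by (simp add: dense_def)
  show ?thesis
  proof (intro exI[of _ R] conjI allI impI)
    show "int p dvd (\<Sum>z\<in>R. int (m z) * (\<Prod>i\<in>I. f i z))" if "\<forall>i\<in>I. f i \<in> W i" for f
      by (rule restrict[OF RX that rich])
  qed (use R in \<open>simp_all add: dense_def\<close>)
qed

end

definition indicat_int :: "'a set \<Rightarrow> 'a \<Rightarrow> int" where
  "indicat_int A = (\<lambda>x. of_bool (x \<in> A))"

section \<open>The rank bound\<close>

text \<open>The situation after points lying in the same members are merged into one point whose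
  weight is the size of its class. The index set \<open>{..p}\<close> has \<open>p + 1\<close>
  elements.\<close>

locale weighted_divisible_family = prime_modulus +
  fixes X :: "'a set" and F :: "'a set set" and m :: "'a \<Rightarrow> nat"
  assumes finite_X: "finite X"
    and F_sub: "F \<subseteq> Pow X"
    and cover: "\<And>x. x \<in> X \<Longrightarrow> \<exists>A\<in>F. x \<in> A"
    and separated: "\<And>x y. x \<in> X \<Longrightarrow> y \<in> X \<Longrightarrow> x \<noteq> y \<Longrightarrow> \<exists>A\<in>F. (x \<in> A) \<noteq> (y \<in> A)"
    and m_pos: "\<And>x. x \<in> X \<Longrightarrow> m x > 0"
    and divisible: "\<And>A. \<forall>i\<in>{..p}. A i \<in> F \<Longrightarrow> p dvd (\<Sum>x\<in>(\<Inter>i\<in>{..p}. A i). m x)"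
begin

definition V :: "('a \<Rightarrow> int) set" where "V = int_span (indicat_int ` F)"

definition U :: "('a \<Rightarrow> int) set" where "U = int_span (insert (\<lambda>_. 1) (indicat_int ` F))"

lemma subspace_V: "int_subspace V" and subspace_U: "int_subspace U"
  by (simp_all add: V_def U_def int_subspace_span)

lemma V_sub_U: "V \<subseteq> U"
  unfolding V_def U_def by (rule int_span_mono) auto

section \<open>Products annihilated by the weights\<close>

lemma indicat_in_V: "A \<in> F \<Longrightarrow> indicat_int A \<in> V"
  unfolding V_def by (rule int_span_base) auto

lemma one_in_U: "(\<lambda>_. 1) \<in> U"
  unfolding U_def by (rule int_span_base) auto

text \<open>By linearity in each factor only generators matter, and their product is the indicator
  of an intersection of \<open>p + 1\<close> members.\<close>

lemma annihilates_V_U: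
  assumes "f 0 \<in> V" "\<forall>i\<in>{1..p}. f i \<in> U"
  shows "int p dvd (\<Sum>x\<in>X. int (m x) * (\<Prod>i\<in>{..p}. f i x))"
proof (rule dvd_sum_prod_int_span)
  let ?G = "\<lambda>i::nat. if i = 0 then indicat_int ` F else insert (\<lambda>_. 1) (indicat_int ` F)"
  show "\<forall>i\<in>{..p}. f i \<in> int_span (?G i)"
    using assms by (auto simp: V_def U_def)
  fix f :: "nat \<Rightarrow> 'a \<Rightarrow> int" assume f: "\<forall>i\<in>{..p}. f i \<in> ?G i"
  from bspec[OF this, of 0] have "f 0 \<in> indicat_int ` F" by simp
  then obtain A0 where A0: "A0 \<in> F" "f 0 = indicat_int A0" by blast
  \<comment> \<open>A constant factor 1 is represented by \<open>A0\<close>, which already occurs as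
    factor 0, so the intersection does not change.\<close>
  have "\<exists>A. A \<in> F \<and> (f i = indicat_int A \<or> A = A0 \<and> f i = (\<lambda>_. 1))" if "i \<in> {..p}" for i
    using bspec[OF f that] A0 by (cases "i = 0") auto
  then have "\<forall>i\<in>{..p}. \<exists>A. A \<in> F \<and> (f i = indicat_int A \<or> A = A0 \<and> f i = (\<lambda>_. 1))" by blast
  from bchoice[OF this] obtain A where
    A: "\<And>i. i \<in> {..p} \<Longrightarrow> A i \<in> F \<and> (f i = indicat_int (A i) \<or> A i = A0 \<and> f i = (\<lambda>_. 1))"
    by blast
  define B where "B = A(0 := A0)"
  have B: "\<forall>i\<in>{..p}. B i \<in> F" using A A0 by (auto simp: B_def)
  have "B 0 \<in> F" using B by simp
  then have sub: "(\<Inter>i\<in>{..p}. B i) \<subseteq> X" using F_sub by auto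
  have "(\<Prod>i\<in>{..p}. f i x) = of_bool (x \<in> (\<Inter>i\<in>{..p}. B i))" for x
  proof (cases "x \<in> A0")
    case True
    have "f i x = of_bool (x \<in> B i)" if "i \<in> {..p}" for i
      using A[OF that] A0 True by (auto simp: B_def indicat_int_def)
    then have "(\<Prod>i\<in>{..p}. f i x) = (\<Prod>i\<in>{..p}. of_bool (x \<in> B i))"
      by (intro prod.cong) auto
    also have "\<dots> = of_bool (\<forall>i\<in>{..p}. x \<in> B i)"
    proof (cases "\<forall>i\<in>{..p}. x \<in> B i")
      case False
      then have "(\<Prod>i\<in>{..p}. of_bool (x \<in> B i) :: int) = 0"
        by (intro prod_zero) auto
      with False show ?thesis by simp
    qed simp
    finally show ?thesis by auto
  next
    case False
    then have "(\<Prod>i\<in>{..p}. f i x) = 0"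
      using A0 by (intro prod_zero) (auto simp: indicat_int_def intro!: bexI[of _ 0])
    moreover have "x \<notin> (\<Inter>i\<in>{..p}. B i)" using False by (auto simp: B_def intro!: bexI[of _ 0])
    ultimately show ?thesis by (simp only: of_bool_eq)
  qed
  then have "(\<Sum>x\<in>X. int (m x) * (\<Prod>i\<in>{..p}. f i x))
    = (\<Sum>x\<in>X. if x \<in> (\<Inter>i\<in>{..p}. B i) then int (m x) else 0)"
    by (intro sum.cong) auto
  also have "\<dots> = (\<Sum>x\<in>X \<inter> (\<Inter>i\<in>{..p}. B i). int (m x))"
    by (rule sum.inter_restrict[OF finite_X, symmetric])
  also have "X \<inter> (\<Inter>i\<in>{..p}. B i) = (\<Inter>i\<in>{..p}. B i)" using sub by blast
  finally show "int p dvd (\<Sum>x\<in>X. int (m x) * (\<Prod>i\<in>{..p}. f i x))"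
    using divisible[OF B] by (simp flip: of_nat_sum)
qed simp

text \<open>Indicators of members or of their complements, 1 at \<open>x\<close> and 0 at some other
  remaining point, are chosen in turn, and each lowers the rank of what remains. All
  \<open>g i\<close>, also for \<open>i \<ge> k\<close>, are 1 at \<open>x\<close>, so that products
  can be padded.\<close>

lemma isolating_product:
  assumes "R \<subseteq> X" "x \<in> R"
  shows "\<exists>k g. k + 1 \<le> rk U R \<and> (\<forall>i. g i \<in> U \<and> g i x = 1) \<and> (\<forall>y\<in>R - {x}. \<exists>i<k. g i y = 0)"
proof -
  have "finite R" using assms finite_X finite_subset by blast
  then show ?thesis using assms
  proof (induction R rule: finite_psubset_induct)
    case (psubset R)
    show ?case
    proof (cases "R = {x}")
      case True
      have "rk U {x} = 1" by (rule rk_singleton[OF subspace_U one_in_U]) (use p_ge_2 in auto)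
      then show ?thesis
        using True one_in_U by (intro exI[of _ 0] exI[of _ "\<lambda>_ _. 1"]) auto
    next
      case False
      then obtain y where y: "y \<in> R" "y \<noteq> x" using psubset.prems by blast
      then obtain A where A: "A \<in> F" "(x \<in> A) \<noteq> (y \<in> A)" using separated psubset.prems by blast
      define h where "h = (if x \<in> A then indicat_int A else (\<lambda>z. 1 - indicat_int A z))"
      have AU: "indicat_int A \<in> U" using indicat_in_V[OF A(1)] V_sub_U by blast
      then have hU: "h \<in> U" and h1U: "(\<lambda>z. 1 - h z) \<in> U"
        using int_subspace_diff[OF subspace_U one_in_U AU] by (auto simp: h_def)
      have h01: "h z = 0 \<or> h z = 1" for z by (auto simp: h_def indicat_int_def)
      have hx: "h x = 1" and hy: "h y = 0" using A by (auto simp: h_def indicat_int_def)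
      define R' where "R' = {z \<in> R. h z = 1}"
      have "y \<notin> R'" using hy by (simp add: R'_def)
      then have R': "R' \<subset> R" "R' \<subseteq> X" "x \<in> R'" using y hx psubset.prems by (auto simp: R'_def)
      have finR': "finite R'" using psubset.hyps R' finite_subset by blast
      obtain k g where kg: "k + 1 \<le> rk U R'" "\<forall>i. g i \<in> U \<and> g i x = 1"
          "\<forall>y\<in>R' - {x}. \<exists>i<k. g i y = 0"
        using psubset.IH[OF R'] by blast
      \<comment> \<open>The function \<open>1 - h\<close> vanishes on \<open>R'\<close> but is 1 at
        \<open>y\<close>, so \<open>y\<close> is independent of \<open>R'\<close>.\<close>
      have "(\<lambda>z. 1 - h z) \<in> ann U R'" using h1U by (simp add: ann_def R'_def)
      then have "dep U R' y \<Longrightarrow> int p dvd 1 - h y" unfolding dep_def by (rule bspec[rotated])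
      then have "\<not> dep U R' y" using hy p_ge_2 by auto
      then have "rk U R' + 1 = rk U (insert y R')" using rk_insert[OF subspace_U finR'] by simp
      also have "\<dots> \<le> rk U R"
        by (rule rk_mono[OF subspace_U psubset.hyps]) (use R' y in auto)
      finally have k: "Suc k + 1 \<le> rk U R" using kg by simp
      have zero: "\<exists>i<Suc k. (g(k := h)) i z = 0" if "z \<in> R - {x}" for z
      proof (cases "z \<in> R'")
        case True
        then have "z \<in> R' - {x}" using that by blast
        from bspec[OF kg(3) this] obtain i where "i < k" "g i z = 0" by blast
        then have "i < Suc k \<and> (g(k := h)) i z = 0" by simp
        then show ?thesis by (rule exI)
      next
        case False
        then have "h z = 0" using that h01[of z] by (auto simp: R'_def)
        then have "k < Suc k \<and> (g(k := h)) k z = 0" by simp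
        then show ?thesis by (rule exI)
      qed
      show ?thesis
      proof (rule exI[of _ "Suc k"], rule exI[of _ "g(k := h)"], intro conjI allI ballI)
        show "(g(k := h)) i \<in> U" "(g(k := h)) i x = 1" for i
          using kg(2) hU hx by simp_all
      qed (fact k, rule zero)
    qed
  qed
qed

text \<open>This is the dense-set lemma with \<open>W\<close> at index 0 and \<open>U\<close> at the
  other \<open>p\<close> indices; the lower bound on \<open>rk U R\<close> holds because a short
  isolating product would contradict annihilation on \<open>R\<close>.\<close>

lemma exists_dense_block:
  assumes W: "int_subspace W" "W \<subseteq> V" and Y: "Y \<subseteq> X" "\<forall>z\<in>Y. \<not> p dvd m z"
    and kill: "\<And>f. f 0 \<in> W \<Longrightarrow> \<forall>i\<in>{1..p}. f i \<in> U \<Longrightarrow>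
      int p dvd (\<Sum>z\<in>Y. int (m z) * (\<Prod>i\<in>{..p}. f i z))"
    and x: "x \<in> Y" "v \<in> W" "\<not> int p dvd v x"
  shows "\<exists>R. R \<subseteq> Y \<and> x \<in> R \<and> p + 2 \<le> rk U R \<and> rk W R + p * rk U R + 1 \<le> card R + p \<and>
    (\<forall>f. f 0 \<in> W \<longrightarrow> (\<forall>i\<in>{1..p}. f i \<in> U) \<longrightarrow> int p dvd (\<Sum>z\<in>R. int (m z) * (\<Prod>i\<in>{..p}. f i z)))"
proof -
  let ?W = "\<lambda>i::nat. if i = 0 then W else U"
  have Wiff: "(\<forall>i\<in>{..p}. f i \<in> ?W i) \<longleftrightarrow> f 0 \<in> W \<and> (\<forall>i\<in>{1..p}. f i \<in> U)" for f
    by (force simp: Ball_def)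
  have one: "\<not> int p dvd 1" using p_ge_2 by auto
  have "finite Y" using Y finite_X finite_subset by blast
  have "\<exists>R. R \<subseteq> Y \<and> x \<in> R \<and> (\<Sum>i\<in>{..p}. rk (?W i) R) + 2 \<le> card R + card {..p} \<and>
    (\<forall>f. (\<forall>i\<in>{..p}. f i \<in> ?W i) \<longrightarrow> int p dvd (\<Sum>z\<in>R. int (m z) * (\<Prod>i\<in>{..p}. f i z)))"
  proof (rule exists_dense_annihilated_set[OF \<open>finite Y\<close> finite_atMost _ Y(2) _ x(1)])
    show "\<forall>i\<in>{..p}. int_subspace (?W i)" using W(1) subspace_U by simp
    show "\<forall>i\<in>{..p}. \<exists>u\<in>?W i. \<not> int p dvd u x"
    proof
      fix i
      show "\<exists>u\<in>?W i. \<not> int p dvd u x"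
        using x(2,3) bexI[OF _ one_in_U, of "\<lambda>u. \<not> int p dvd u x"] one by (cases "i = 0") auto
    qed
    show "int p dvd (\<Sum>z\<in>Y. int (m z) * (\<Prod>i\<in>{..p}. f i z))" if "\<forall>i\<in>{..p}. f i \<in> ?W i" for f
      using that kill unfolding Wiff by blast
  qed
  then obtain R where
    R: "R \<subseteq> Y" "x \<in> R" "(\<Sum>i\<in>{..p}. rk (?W i) R) + 2 \<le> card R + card {..p}"
      "\<forall>f. (\<forall>i\<in>{..p}. f i \<in> ?W i) \<longrightarrow> int p dvd (\<Sum>z\<in>R. int (m z) * (\<Prod>i\<in>{..p}. f i z))"
    by blast
  have "(\<Sum>i\<in>{..p}. rk (?W i) R) = rk W R + (\<Sum>i\<in>{1..p}. rk (?W i) R)"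
    by (simp only: atMost_atLeast0 sum.atLeast_Suc_atMost[OF le0] One_nat_def) simp
  also have "(\<Sum>i\<in>{1..p}. rk (?W i) R) = (\<Sum>i\<in>{1..p}. rk U R)" by (rule sum.cong) auto
  also have "\<dots> = p * rk U R" by simp
  finally have card: "rk W R + p * rk U R + 1 \<le> card R + p" using R(3) by simp
  have killR: "int p dvd (\<Sum>z\<in>R. int (m z) * (\<Prod>i\<in>{..p}. f i z))"
    if "f 0 \<in> W" "\<forall>i\<in>{1..p}. f i \<in> U" for f
    using R(4) that unfolding Wiff by blast
  have "p + 2 \<le> rk U R"
  proof (rule ccontr)
    assume "\<not> ?thesis"
    moreover obtain k g where kg: "k + 1 \<le> rk U R" "\<forall>i. g i \<in> U \<and> g i x = 1"
        "\<forall>y\<in>R - {x}. \<exists>i<k. g i y = 0"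
      using isolating_product[of R x] R Y by blast
    ultimately have "k \<le> p" by simp
    \<comment> \<open>If the rank were at most \<open>p + 1\<close>, at most \<open>p\<close>
      factors would isolate \<open>x\<close>. With \<open>v\<close> in front and padding they fill
      the \<open>p + 1\<close> slots, and only the term at \<open>x\<close> survives.\<close>
    define f where "f i = (if i = 0 then v else g (i - 1))" for i :: nat
    have split: "(\<Prod>i\<in>{..p}. f i z) = v z * (\<Prod>i<p. g i z)" for z
      by (simp add: f_def prod.atMost_shift)
    have "int p dvd (\<Sum>z\<in>R. int (m z) * (\<Prod>i\<in>{..p}. f i z))"
      using kg x by (intro killR) (auto simp: f_def)
    also have "(\<Sum>z\<in>R. int (m z) * (\<Prod>i\<in>{..p}. f i z)) = (\<Sum>z\<in>{x}. int (m z) * (\<Prod>i\<in>{..p}. f i z))"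
    proof (rule sum.mono_neutral_right)
      show "finite R" using R \<open>finite Y\<close> finite_subset by blast
      show "{x} \<subseteq> R" using R by simp
      show "\<forall>z\<in>R - {x}. int (m z) * (\<Prod>i\<in>{..p}. f i z) = 0"
      proof
        fix z assume "z \<in> R - {x}"
        then obtain i where "i < k" "g i z = 0" using kg(3) by blast
        then have "(\<Prod>i<p. g i z) = 0" using \<open>k \<le> p\<close> by (intro prod_zero) auto
        then show "int (m z) * (\<Prod>i\<in>{..p}. f i z) = 0" by (simp add: split)
      qed
    qed
    also have "\<dots> = int (m x) * v x" using kg(2) by (simp add: split)
    finally show False
      using x Y prime_int_p by (auto simp: prime_dvd_mult_iff)
  qed
  with R card killR show ?thesis by blast
qed

text \<open>Modulo \<open>p\<close>, points of \<open>T\<close> contribute nothing because factor 0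
  vanishes there, and points of weight divisible by \<open>p\<close> contribute nothing
  either.\<close>

lemma annihilates_outside:
  assumes "f 0 \<in> ann V T" "\<forall>i\<in>{1..p}. f i \<in> U"
  shows "int p dvd (\<Sum>z\<in>{z \<in> X - T. \<not> p dvd m z}. int (m z) * (\<Prod>i\<in>{..p}. f i z))"
proof -
  let ?Y = "{z \<in> X - T. \<not> p dvd m z}" and ?s = "\<lambda>z. int (m z) * (\<Prod>i\<in>{..p}. f i z)"
  have "int p dvd sum ?s X" using assms by (intro annihilates_V_U) (auto simp: ann_def)
  moreover have "sum ?s X = sum ?s (X - ?Y) + sum ?s ?Y"
    by (rule sum.subset_diff) (use finite_X in auto)
  moreover have "int p dvd sum ?s (X - ?Y)"
  proof (rule dvd_sum)
    fix z assume "z \<in> X - ?Y"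
    then have "p dvd m z \<or> int p dvd f 0 z" using assms(1) by (auto simp: ann_def)
    moreover have "f 0 z dvd (\<Prod>i\<in>{..p}. f i z)" by (rule dvd_prodI) auto
    ultimately show "int p dvd ?s z" by (meson dvd_mult dvd_mult2 dvd_trans of_nat_dvd_iff)
  qed
  ultimately show ?thesis by (simp add: dvd_add_right_iff)
qed

section \<open>Heavy blocks and the resulting rank bound\<close>

lemma card_le_sum_m:
  assumes "R \<subseteq> X" shows "card R \<le> sum m R"
proof -
  have "(\<Sum>x\<in>R. 1) \<le> sum m R" using assms m_pos by (intro sum_mono) (auto simp: Suc_le_eq)
  then show ?thesis by simp
qed

text \<open>If \<open>p\<close> divides \<open>m x\<close>, the point alone weighs at least
  \<open>p\<close>; otherwise a dense block serves. The rank is taken in \<open>ann V T\<close>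
  because this is what \<open>R\<close> adds to the rank of \<open>T\<close>.\<close>

lemma extension_step:
  assumes T: "T \<subseteq> X" and x: "x \<in> X" and v: "v \<in> ann V T" "\<not> int p dvd v x"
  shows "\<exists>R. R \<subseteq> X - T \<and> x \<in> R \<and> p * rk (ann V T) R \<le> sum m R"
proof (cases "p dvd m x")
  case True
  have "rk (ann V T) {x} = 1" using rk_singleton[OF int_subspace_ann[OF subspace_V] v] .
  moreover have "p \<le> m x" using True m_pos[OF x] by (intro dvd_imp_le) auto
  moreover have "x \<notin> T" using v by (auto simp: ann_def)
  ultimately show ?thesis using x by (intro exI[of _ "{x}"]) auto
next
  case False
  let ?W = "ann V T"
  have W: "int_subspace ?W" "?W \<subseteq> V" using int_subspace_ann[OF subspace_V] ann_subset by auto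
  have xT: "x \<notin> T" using v by (auto simp: ann_def)
  let ?Y = "{z \<in> X - T. \<not> p dvd m z}"
  have "x \<in> ?Y" using x xT False by simp
  then have "\<exists>R. R \<subseteq> ?Y \<and> x \<in> R \<and> p + 2 \<le> rk U R \<and> rk ?W R + p * rk U R + 1 \<le> card R + p \<and>
    (\<forall>f. f 0 \<in> ?W \<longrightarrow> (\<forall>i\<in>{1..p}. f i \<in> U) \<longrightarrow> int p dvd (\<Sum>z\<in>R. int (m z) * (\<Prod>i\<in>{..p}. f i z)))"
    by (intro exists_dense_block[OF W _ _ annihilates_outside _ v]) auto
  then obtain R where R: "R \<subseteq> ?Y" "x \<in> R" "p + 2 \<le> rk U R"
      "rk ?W R + p * rk U R + 1 \<le> card R + p" by blast
  have finR: "finite R" using R finite_X by (auto intro: finite_subset)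
  have le: "rk ?W R \<le> rk U R"
    using W V_sub_U by (intro rk_subspace_mono subspace_U finR) auto
  \<comment> \<open>If the two ranks agree, being at least \<open>p + 2\<close> they make up for the
    \<open>p\<close> on the right of the density bound; otherwise the larger rank of
    \<open>U\<close> contributes another \<open>p\<close>.\<close>
  have "p * rk ?W R \<le> card R"
  proof (cases "rk ?W R = rk U R")
    case True
    then show ?thesis using R by simp
  next
    case False
    then have "p * (rk ?W R + 1) \<le> p * rk U R" using le by (intro mult_le_mono) auto
    then show ?thesis using R(4) by simp
  qed
  also have "\<dots> \<le> sum m R" using R by (intro card_le_sum_m) auto
  finally show ?thesis using R by (intro exI[of _ R]) auto
qed

text \<open>The first block supplies the extra summand \<open>p\<close> of the final bound. Density
  suffices when \<open>U\<close> has larger rank than \<open>V\<close> on \<open>R\<close>; for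
  equal ranks a congruence helps.\<close>

lemma initial_block:
  assumes x: "x \<in> X" "\<not> p dvd m x"
  shows "\<exists>R\<subseteq>X. p * (rk V R + 1) \<le> sum m R"
proof -
  obtain A where A: "A \<in> F" "x \<in> A" using cover[OF x(1)] by blast
  have v: "\<not> int p dvd indicat_int A x" using A p_ge_2 by (auto simp: indicat_int_def)
  let ?Y = "{z \<in> X - {}. \<not> p dvd m z}"
  have ann: "ann V {} = V" by (simp add: ann_def)
  have "x \<in> ?Y" using x by simp
  then have "\<exists>R. R \<subseteq> ?Y \<and> x \<in> R \<and> p + 2 \<le> rk U R \<and> rk V R + p * rk U R + 1 \<le> card R + p \<and>
    (\<forall>f. f 0 \<in> V \<longrightarrow> (\<forall>i\<in>{1..p}. f i \<in> U) \<longrightarrow> int p dvd (\<Sum>z\<in>R. int (m z) * (\<Prod>i\<in>{..p}. f i z)))"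
    by (intro exists_dense_block[OF subspace_V subset_refl _ _
          annihilates_outside[where T = "{}", unfolded ann] _ indicat_in_V[OF A(1)] v]) auto
  then obtain R where R: "R \<subseteq> ?Y" "x \<in> R" "p + 2 \<le> rk U R"
      "rk V R + p * rk U R + 1 \<le> card R + p"
      "\<forall>f. f 0 \<in> V \<longrightarrow> (\<forall>i\<in>{1..p}. f i \<in> U) \<longrightarrow> int p dvd (\<Sum>z\<in>R. int (m z) * (\<Prod>i\<in>{..p}. f i z))"
    by blast
  have RX: "R \<subseteq> X" and finR: "finite R" using R finite_X by (auto intro: finite_subset)
  have mR: "card R \<le> sum m R" by (rule card_le_sum_m[OF RX])
  have le: "rk V R \<le> rk U R"
    by (rule rk_subspace_mono[OF subspace_V subspace_U V_sub_U finR])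
  consider "rk V R = rk U R" | "rk V R + 1 = rk U R" | "rk V R + 2 \<le> rk U R" using le by linarith
  then have "p * (rk V R + 1) \<le> sum m R"
  proof cases
    case 1
    \<comment> \<open>The constant 1 agrees on \<open>R\<close> modulo \<open>p\<close> with some
      \<open>e\<close> in \<open>V\<close>, so annihilation gives \<open>p dvd sum m R\<close>; a
      multiple of \<open>p\<close> exceeding \<open>p * rk V R\<close> is at least
      \<open>p * (rk V R + 1)\<close>.\<close>
    obtain e where e: "e \<in> V" "\<forall>s\<in>R. e s mod int p = 1 mod int p"
      using rk_eq_imp_residues[OF subspace_V subspace_U V_sub_U finR 1 one_in_U] by blast
    define f where "f i = (if i = 0 then e else (\<lambda>_. 1))" for i :: nat
    have f: "(\<Prod>i\<in>{..p}. f i z) = e z" for z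
      by (simp add: f_def prod.atMost_shift)
    have "int p dvd (\<Sum>z\<in>R. int (m z) * (\<Prod>i\<in>{..p}. f i z))"
      using R(5) e(1) one_in_U by (auto simp: f_def)
    then have "int p dvd (\<Sum>z\<in>R. int (m z) * e z)" by (simp add: f)
    moreover have "[(\<Sum>z\<in>R. int (m z) * e z) = (\<Sum>z\<in>R. int (m z) * 1)] (mod int p)"
      using e(2) by (intro cong_sum cong_mult) (auto simp: cong_def)
    ultimately have "int p dvd int (sum m R)" by (simp add: cong_dvd_iff)
    then have "p dvd sum m R" by (simp only: of_nat_dvd_iff)
    then obtain q where q: "sum m R = p * q" by blast
    have "p * rk V R < sum m R" using R(3,4) mR unfolding 1 by linarith
    then have "p * rk V R < p * q" using q by simp
    then have "rk V R + 1 \<le> q" by simp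
    then show ?thesis unfolding q by (rule mult_le_mono2)
  next
    \<comment> \<open>Here \<open>rk V R \<ge> p + 1\<close>, which outweighs the \<open>p\<close>
      on the right of the density bound.\<close>
    case 2
    then show ?thesis using R(3,4) mR unfolding 2[symmetric] by simp
  next
    case 3
    then have "p * (rk V R + 2) \<le> p * rk U R" by (intro mult_le_mono) auto
    then show ?thesis using R(4) mR by simp
  qed
  then show ?thesis using RX by blast
qed

text \<open>Take a largest \<open>T\<close> satisfying the bound. A point independent of
  \<open>T\<close> would yield a block whose weight is at least \<open>p\<close> times the rank it
  adds, enlarging \<open>T\<close>; so \<open>T\<close> already has the full rank of
  \<open>X\<close>.\<close>

lemma rk_bound:
  assumes "\<exists>x\<in>X. \<not> p dvd m x"
  shows "p * (rk V X + 1) \<le> sum m X"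
proof -
  define good where "good T \<longleftrightarrow> T \<subseteq> X \<and> p * (rk V T + 1) \<le> sum m T" for T
  have "\<exists>T. good T" using initial_block assms by (auto simp: good_def)
  then obtain T0 where T0: "good T0" by blast
  have "\<forall>T. good T \<longrightarrow> card T < Suc (card X)"
    using finite_X by (auto simp: good_def less_Suc_eq_le intro: card_mono)
  from ex_has_greatest_nat[OF T0 this]
  obtain T where T: "good T" and max: "\<And>S. good S \<Longrightarrow> card S \<le> card T" by blast
  have TX: "T \<subseteq> X" and finT: "finite T" using T finite_X finite_subset by (auto simp: good_def)
  have dep: "dep V T x" if x: "x \<in> X" for x
  proof (rule ccontr)
    assume "\<not> dep V T x"
    then obtain v where "v \<in> ann V T" "\<not> int p dvd v x" by (auto simp: dep_def)
    then obtain R where R: "R \<subseteq> X - T" "x \<in> R" "p * rk (ann V T) R \<le> sum m R"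
      using extension_step[OF TX x] by blast
    have finR: "finite R" using R finite_X by (auto intro: finite_subset)
    have "sum m (T \<union> R) = sum m T + sum m R"
      using R finT finR by (intro sum.union_disjoint) auto
    moreover have "rk V (T \<union> R) = rk V T + rk (ann V T) R"
      by (rule rk_Un[OF subspace_V finT finR])
    ultimately have "good (T \<union> R)"
      using T R TX by (auto simp: good_def algebra_simps)
    moreover have "T \<subset> T \<union> R" using R by auto
    then have "card T < card (T \<union> R)" by (intro psubset_card_mono) (use finT finR in auto)
    ultimately show False using max[of "T \<union> R"] by simp
  qed
  have "rk V (T \<union> D) = rk V T" if "finite D" "D \<subseteq> X" for D
    using that
  proof (induction D rule: finite_induct)
    case (insert y D)
    have "dep V (T \<union> D) y" using dep[of y] insert.prems by (auto intro: dep_mono)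
    then show ?case using insert finT by (simp add: rk_insert[OF subspace_V])
  qed simp
  from this[OF finite_X] have "rk V X = rk V T" using TX by (simp add: Un_absorb1)
  moreover have "sum m T \<le> sum m X" using TX finite_X by (intro sum_mono2) auto
  ultimately show ?thesis using T by (simp add: good_def)
qed

text \<open>Traces of members are 0/1 vectors: a new independent point at most doubles their number,
  and at a dependent point membership is determined by the trace so far.\<close>

lemma card_F_le: "card F \<le> 2 ^ rk V X"
proof -
  have "card ((\<lambda>A. A \<inter> S) ` F) \<le> 2 ^ rk V S" if "finite S" for S
    using that
  proof (induction S rule: finite_induct)
    case empty
    have "(\<lambda>A. A \<inter> {}) ` F \<subseteq> {{}}" by auto
    then have "card ((\<lambda>A. A \<inter> {}) ` F) \<le> card {{} :: 'a set}" by (intro card_mono) auto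
    then show ?case by (simp add: rk_empty[OF subspace_V])
  next
    case (insert y S)
    have finF: "finite F" using F_sub finite_X finite_subset by blast
    show ?case
    proof (cases "dep V S y")
      case True
      have eq: "A \<inter> insert y S = B \<inter> insert y S" if AB: "A \<in> F" "B \<in> F" "A \<inter> S = B \<inter> S" for A B
      proof -
        have "indicat_int A s = indicat_int B s" if "s \<in> S" for s
          using AB(3) that by (auto simp: indicat_int_def)
        then have "(\<lambda>x. indicat_int A x - indicat_int B x) \<in> ann V S"
          using int_subspace_diff[OF subspace_V indicat_in_V[OF AB(1)] indicat_in_V[OF AB(2)]]
          by (simp add: ann_def)
        then have "int p dvd indicat_int A y - indicat_int B y" using True by (auto simp: dep_def)
        \<comment> \<open>A difference of two indicator values is -1, 0 or 1, so divisibility by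
          \<open>p\<close> forces it to be 0.\<close>
        moreover have "\<not> int p dvd 1" "\<not> int p dvd - 1" using p_ge_2 by auto
        ultimately have "y \<in> A \<longleftrightarrow> y \<in> B"
          by (cases "y \<in> A"; cases "y \<in> B") (simp_all add: indicat_int_def)
        then show ?thesis using AB by auto
      qed
      have "inj_on (\<lambda>C. C \<inter> S) ((\<lambda>A. A \<inter> insert y S) ` F)"
      proof (rule inj_onI)
        fix C D
        assume "C \<in> (\<lambda>A. A \<inter> insert y S) ` F" "D \<in> (\<lambda>A. A \<inter> insert y S) ` F" and CD: "C \<inter> S = D \<inter> S"
        then obtain A B where AB: "A \<in> F" "C = A \<inter> insert y S" "B \<in> F" "D = B \<inter> insert y S" by blast
        have "A \<inter> S = B \<inter> S" using CD unfolding AB(2,4) by blast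
        then show "C = D" unfolding AB(2,4) by (rule eq[OF AB(1,3)])
      qed
      then have "card ((\<lambda>A. A \<inter> insert y S) ` F) = card ((\<lambda>C. C \<inter> S) ` (\<lambda>A. A \<inter> insert y S) ` F)"
        by (rule card_image[symmetric])
      also have "(\<lambda>C. C \<inter> S) ` (\<lambda>A. A \<inter> insert y S) ` F = (\<lambda>A. A \<inter> S) ` F"
        unfolding image_image by (rule image_cong) auto
      finally show ?thesis using insert True by (simp add: rk_insert[OF subspace_V])
    next
      case False
      have "(\<lambda>A. A \<inter> insert y S) ` F \<subseteq> (\<lambda>A. A \<inter> S) ` F \<union> insert y ` (\<lambda>A. A \<inter> S) ` F"
      proof
        fix B assume "B \<in> (\<lambda>A. A \<inter> insert y S) ` F"
        then obtain A where "A \<in> F" "B = A \<inter> insert y S" by blast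
        moreover from this have "B = A \<inter> S \<or> B = insert y (A \<inter> S)" by auto
        ultimately show "B \<in> (\<lambda>A. A \<inter> S) ` F \<union> insert y ` (\<lambda>A. A \<inter> S) ` F" by auto
      qed
      then have "card ((\<lambda>A. A \<inter> insert y S) ` F) \<le> card ((\<lambda>A. A \<inter> S) ` F \<union> insert y ` (\<lambda>A. A \<inter> S) ` F)"
        using finF by (intro card_mono) auto
      also have "\<dots> \<le> card ((\<lambda>A. A \<inter> S) ` F) + card (insert y ` (\<lambda>A. A \<inter> S) ` F)"
        by (rule card_Un_le)
      also have "\<dots> \<le> 2 * card ((\<lambda>A. A \<inter> S) ` F)"
        using card_image_le[of "(\<lambda>A. A \<inter> S) ` F" "insert y"] finF by simp
      finally show ?thesis using insert False by (simp add: rk_insert[OF subspace_V])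
    qed
  qed
  moreover have "(\<lambda>A. A \<inter> X) ` F = F"
  proof -
    have "(\<lambda>A. A \<inter> X) ` F = (\<lambda>A. A) ` F" using F_sub by (intro image_cong) auto
    then show ?thesis by simp
  qed
  ultimately show ?thesis using finite_X by fastforce
qed

end

section \<open>Reduction to atoms\<close>

lemma exists_disjoint_blocks:
  assumes "finite C" "p dvd card C" "p > 0"
  shows "\<exists>P. disjoint P \<and> \<Union>P = C \<and> (\<forall>B\<in>P. card B = p)"
  using assms(1,2)
proof (induction C rule: finite_psubset_induct)
  case (psubset C)
  show ?case
  proof (cases "C = {}")
    case True
    then show ?thesis by (intro exI[of _ "{}"]) auto
  next
    case False
    then have "p \<le> card C" using psubset by (intro dvd_imp_le) (auto simp: card_gt_0_iff)
    then obtain B where B: "B \<subseteq> C" "card B = p" using obtain_subset_with_card_n by metis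
    then have "B \<noteq> {}" using assms(3) by auto
    then have "C - B \<subset> C" using B by auto
    moreover have "p dvd card (C - B)"
      using card_Diff_subset[OF finite_subset[OF B(1) psubset.hyps] B(1)] B(2) psubset.prems
      by (simp add: dvd_diff_nat)
    ultimately obtain P where P: "disjoint P" "\<Union>P = C - B" "\<forall>B\<in>P. card B = p"
      using psubset.IH[of "C - B"] by auto
    have "disjnt B D" if "D \<in> P" for D using P(2) that by (auto simp: disjnt_def)
    then have "disjoint (insert B P)"
      using P(1) by (simp add: pairwise_insert disjnt_sym)
    moreover have "\<Union>(insert B P) = C" using P(2) B(1) by auto
    moreover have "\<forall>D\<in>insert B P. card D = p" using P(3) B(2) by simp
    ultimately show ?thesis by blast
  qed
qed

theorem theorem1p2:
  fixes p n :: nat and F :: "nat set set"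
  assumes "prime p"
    and "n \<ge> 1"
    and "F \<subseteq> Pow {1..n}"
    and "wise_divisible (p + 1) p F"
    and "real (card F) > 2 powi (\<lfloor>real n / real p\<rfloor> - 1)"
  shows "\<exists>Bs G. atomic_family_on {1..n} Bs G \<and> (\<forall>B\<in>Bs. card B = p) \<and> F \<subseteq> G"
proof -
  interpret prime_modulus p by unfold_locales (rule assms(1))
  define atom where "atom i = {j \<in> {1..n}. \<forall>A\<in>F. i \<in> A \<longleftrightarrow> j \<in> A}" for i
  \<comment> \<open>Only classes of points covered by \<open>F\<close> are kept, so that every class
    lies inside some member.\<close>
  define X where "X = atom ` \<Union>F"
  \<comment> \<open>The member \<open>A\<close> as the set of its classes; nothing is lost, since
    their union is \<open>A\<close> again.\<close>
  define up where "up A = {C \<in> X. C \<subseteq> A}" for A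
  have FU: "\<Union>F \<subseteq> {1..n}" using assms(3) by auto
  have self: "i \<in> atom i" if "i \<in> \<Union>F" for i using that FU by (auto simp: atom_def)
  have finU: "finite (\<Union>F)" using FU finite_subset by blast
  then have finX: "finite X" by (simp add: X_def)
  have X_sub: "C \<subseteq> {1..n}" if "C \<in> X" for C using that unfolding X_def atom_def by blast
  have finC: "finite C" if "C \<in> X" for C using finite_subset[OF X_sub[OF that]] by simp
  have disjX: "disjoint X"
  proof (rule disjointI)
    fix C D assume "C \<in> X" "D \<in> X" "C \<noteq> D"
    then obtain i j where ij: "C = atom i" "D = atom j" by (auto simp: X_def)
    show "C \<inter> D = {}"
    proof (rule ccontr)
      assume "C \<inter> D \<noteq> {}"
      then obtain z where "z \<in> atom i" "z \<in> atom j" using ij by blast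
      then have "\<forall>A\<in>F. i \<in> A \<longleftrightarrow> j \<in> A" unfolding atom_def by blast
      then have "atom i = atom j" by (simp add: atom_def)
      then show False using ij \<open>C \<noteq> D\<close> by simp
    qed
  qed
  have sub_iff: "atom i \<subseteq> A \<longleftrightarrow> i \<in> A" if "i \<in> \<Union>F" "A \<in> F" for i A
    using self[OF that(1)] that(2) by (auto simp: atom_def)
  have Un_up: "\<Union>(up A) = A" if "A \<in> F" for A
  proof
    show "A \<subseteq> \<Union>(up A)"
    proof
      fix i assume "i \<in> A"
      then have "i \<in> \<Union>F" using that by blast
      then have "atom i \<in> up A" using sub_iff[of i A] \<open>i \<in> A\<close> that by (simp add: up_def X_def)
      then show "i \<in> \<Union>(up A)" using self[OF \<open>i \<in> \<Union>F\<close>] by blast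
    qed
  qed (auto simp: up_def)
  have card_Un: "card (\<Union>Y) = sum card Y" if "Y \<subseteq> X" for Y
    using pairwise_subset[OF disjX that] finC that by (intro card_Union_disjoint) auto
  show ?thesis
  proof (cases "\<forall>C\<in>X. p dvd card C")
    case True
    then have "\<forall>C\<in>X. \<exists>P. disjoint P \<and> \<Union>P = C \<and> (\<forall>B\<in>P. card B = p)"
      using exists_disjoint_blocks[OF finC _ p_pos] by simp
    from bchoice[OF this] obtain P where
      "\<forall>C\<in>X. disjoint (P C) \<and> \<Union>(P C) = C \<and> (\<forall>B\<in>P C. card B = p)" ..
    note P = bspec[OF this]
    define Bs where "Bs = (\<Union>C\<in>X. P C)"
    have "disjoint Bs"
    proof (rule disjointI)
      fix B D assume "B \<in> Bs" "D \<in> Bs" "B \<noteq> D"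
      then obtain C E where CE: "C \<in> X" "B \<in> P C" "E \<in> X" "D \<in> P E" by (auto simp: Bs_def)
      show "B \<inter> D = {}"
      proof (cases "C = E")
        case True
        have "disjoint (P C)" using P[OF CE(1)] by simp
        from disjointD[OF this] show ?thesis using CE True \<open>B \<noteq> D\<close> by simp
      next
        case False
        have "B \<subseteq> C" "D \<subseteq> E" using CE P[OF CE(1)] P[OF CE(3)] by blast+
        then show ?thesis using disjointD[OF disjX CE(1,3) False] by blast
      qed
    qed
    moreover have "Bs \<subseteq> Pow {1..n}"
    proof
      fix B assume "B \<in> Bs"
      then obtain C where "C \<in> X" "B \<in> P C" by (auto simp: Bs_def)
      then show "B \<in> Pow {1..n}" using P[of C] X_sub[of C] by blast
    qed
    moreover have "\<forall>B\<in>Bs. card B = p" using P by (auto simp: Bs_def)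
    moreover have "F \<subseteq> {\<Union>S |S. S \<subseteq> Bs}"
    proof
      fix A assume "A \<in> F"
      have "\<Union>(\<Union>C\<in>up A. P C) = (\<Union>C\<in>up A. \<Union>(P C))" by blast
      also have "\<dots> = \<Union>(up A)" using P by (auto simp: up_def)
      also have "\<dots> = A" by (rule Un_up[OF \<open>A \<in> F\<close>])
      finally have "A = \<Union>(\<Union>C\<in>up A. P C)" by (rule sym)
      moreover have "(\<Union>C\<in>up A. P C) \<subseteq> Bs" by (auto simp: Bs_def up_def)
      ultimately show "A \<in> {\<Union>S |S. S \<subseteq> Bs}" by blast
    qed
    ultimately show ?thesis
      unfolding atomic_family_on_def by blast
  next
    case False
    \<comment> \<open>With class sizes as weights, the weighted sum over an intersection of sets of
      classes counts the points in the intersection of the members.\<close>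
    interpret weighted_divisible_family p X "up ` F" card
    proof unfold_locales
      show "finite X" by (rule finX)
      show "up ` F \<subseteq> Pow X" by (auto simp: up_def)
    next
      fix C assume "C \<in> X"
      then obtain i A where "C = atom i" "i \<in> A" "A \<in> F" by (auto simp: X_def)
      moreover from this have "i \<in> \<Union>F" by blast
      ultimately have "C \<in> up A" "i \<in> C"
        using sub_iff[of i A] self[of i] \<open>C \<in> X\<close> by (simp_all add: up_def)
      then show "\<exists>A\<in>up ` F. C \<in> A" "card C > 0"
        using \<open>A \<in> F\<close> finC[OF \<open>C \<in> X\<close>] by (auto simp: card_gt_0_iff)
    next
      fix C D assume CD: "C \<in> X" "D \<in> X" "C \<noteq> D"
      then obtain i j where ij: "C = atom i" "D = atom j" "i \<in> \<Union>F" "j \<in> \<Union>F" by (auto simp: X_def)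
      then have "\<not> (\<forall>A\<in>F. i \<in> A \<longleftrightarrow> j \<in> A)" using CD(3) by (auto simp: atom_def)
      then obtain A where A: "A \<in> F" "(i \<in> A) \<noteq> (j \<in> A)" by blast
      then have "(C \<in> up A) \<noteq> (D \<in> up A)"
        using CD(1,2) sub_iff[OF ij(3) A(1)] sub_iff[OF ij(4) A(1)] unfolding ij(1,2) by (simp add: up_def)
      then show "\<exists>A\<in>up ` F. (C \<in> A) \<noteq> (D \<in> A)" using A by blast
    next
      fix A assume "\<forall>i\<in>{..p}. A i \<in> up ` F"
      then have "\<forall>i\<in>{..p}. \<exists>B. B \<in> F \<and> A i = up B" by blast
      from bchoice[OF this] obtain B where B: "\<And>i. i \<in> {..p} \<Longrightarrow> B i \<in> F \<and> A i = up (B i)" by blast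
      have "\<forall>i\<in>{1..p+1}. B (i - 1) \<in> F" using B by auto
      then have "p dvd card (\<Inter>i\<in>{1..p+1}. B (i - 1))"
        using spec[OF assms(4)[unfolded wise_divisible_def], of "\<lambda>i. B (i - 1)"] by blast
      also have "(\<Inter>i\<in>{1..p+1}. B (i - 1)) = (\<Inter>i\<in>{..p}. B i)"
      proof -
        have "{1..p+1} = Suc ` {..p}" by (simp add: atMost_atLeast0 image_Suc_atLeastAtMost)
        then show ?thesis by (simp add: image_image)
      qed
      also have "(\<Inter>i\<in>{..p}. B i) = \<Union>(\<Inter>i\<in>{..p}. A i)"
      proof
        show "(\<Inter>i\<in>{..p}. B i) \<subseteq> \<Union>(\<Inter>i\<in>{..p}. A i)"
        proof
          fix z assume z: "z \<in> (\<Inter>i\<in>{..p}. B i)"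
          then have "z \<in> \<Union>F" using B[of 0] by auto
          have "atom z \<in> A i" if "i \<in> {..p}" for i
          proof -
            have "z \<in> B i" using z that by blast
            then show ?thesis
              using B[OF that] sub_iff[OF \<open>z \<in> \<Union>F\<close>] \<open>z \<in> \<Union>F\<close> by (simp add: up_def X_def)
          qed
          then show "z \<in> \<Union>(\<Inter>i\<in>{..p}. A i)" using self[OF \<open>z \<in> \<Union>F\<close>] by blast
        qed
        show "\<Union>(\<Inter>i\<in>{..p}. A i) \<subseteq> (\<Inter>i\<in>{..p}. B i)"
        proof (rule subsetI, rule INT_I)
          fix z i assume "z \<in> \<Union>(\<Inter>i\<in>{..p}. A i)" and i: "i \<in> {..p}"
          then obtain C where "z \<in> C" "C \<in> A i" by blast
          then show "z \<in> B i" using B[OF i] by (auto simp: up_def)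
        qed
      qed
      also have "card (\<Union>(\<Inter>i\<in>{..p}. A i)) = (\<Sum>C\<in>(\<Inter>i\<in>{..p}. A i). card C)"
      proof (rule card_Un)
        have "(\<Inter>i\<in>{..p}. A i) \<subseteq> A 0" by blast
        also have "A 0 \<subseteq> X" using B[of 0] by (simp add: up_def)
        finally show "(\<Inter>i\<in>{..p}. A i) \<subseteq> X" .
      qed
      finally show "p dvd (\<Sum>C\<in>(\<Inter>i\<in>{..p}. A i). card C)" .
    qed
    define k where "k = rk V X"
    have "inj_on up F" using Un_up by (metis inj_onI)
    then have kF: "card F \<le> 2 ^ k" using card_F_le by (simp add: card_image k_def)
    \<comment> \<open>The classes are disjoint, so their total weight is the number of covered
      points.\<close>
    have "p * (k + 1) \<le> card (\<Union>X)" using rk_bound False card_Un[of X] by (auto simp: k_def)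
    also have "\<dots> \<le> card {1..n}" using X_sub by (intro card_mono) auto
    finally have "p * (k + 1) \<le> n" by simp
    then have "real (p * (k + 1)) \<le> real n" by (simp only: of_nat_le_iff)
    then have "real (k + 1) * real p \<le> real n" by (simp only: of_nat_mult mult.commute)
    then have "real (k + 1) \<le> real n / real p"
      using p_pos by (simp add: pos_le_divide_eq)
    \<comment> \<open>Since \<open>k + 1\<close> is an integer at most \<open>n / p\<close>, it is
      at most the floor, and \<open>card F \<le> 2 ^ k\<close> then contradicts the assumed size of
      \<open>F\<close>.\<close>
    then have "int k \<le> \<lfloor>real n / real p\<rfloor> - 1" by linarith
    then have "(2::real) powi int k \<le> 2 powi (\<lfloor>real n / real p\<rfloor> - 1)"
      by (intro power_int_increasing) auto
    moreover have "real (card F) \<le> real (2 ^ k)" using kF by (simp only: of_nat_le_iff)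
    moreover have "real (2 ^ k) = 2 powi int k" by simp
    ultimately have False using assms(5) by linarith
    then show ?thesis ..
  qed
qed

end
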